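(* Let $\ell,m_0\in\mathbb{C}$ be such that $q^{2m}\neq -1$ for all $m\in m_0+\mathbb{Z}$. Let $V_{m_0}^{\ell}=\bigoplus_{m\in m_0+\mathbb{Z}}\mathbb{C}\,|m\rangle$ be the complex vector space with basis $\{|m\rangle : m\in m_0+\mathbb{Z}\}$. Then the formulas $$I_{21}.|m\rangle=i[m]\,|m\rangle,$$ $$I_{32}.|m\rangle=\frac{[\ell+m+1][\ell-m]}{(q^{m}+q^{-m})(q^{m+1}+q^{-m-1})}\,|m+1\rangle-|m-1\rangle$$ (for all $m\in m_0+\mathbb{Z}$) define a representation of $U_q^{\mathrm{tw}}(\mathfrak{so}_3)$ on $V_{m_0}^{\ell}$.
   Context: Fix $h\in\mathbb{C}\setminus 2\pi i\mathbb{Q}$, where $i=\sqrt{-1}$, and put $q=\exp(h)$, so $q$ is not a root of unity. For $b\in\mathbb{C}$ put $q^b=\exp(hb)$ and $[b]=\frac{q^b-q^{-b}}{q-q^{-1}}$. The algebra $U_q^{\mathrm{tw}}(\mathfrak{so}_3)$ is the complex unital associative algebra generated by $I_{21},I_{32}$ subject to $$I_{32}^2I_{21}-[2]I_{32}I_{21}I_{32}+I_{21}I_{32}^2=-I_{21},\qquad I_{21}^2I_{32}-[2]I_{21}I_{32}I_{21}+I_{32}I_{21}^2=-I_{32}.$$ *)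

theory Defs
  imports
    Complex_Main
    "HOL-Library.Poly_Mapping"
    "HOL-Library.FuncSet"
    "HOL-Algebra.QuotRing"
    "HOL-Algebra.Algebraic_Closure_Type"
begin

definition qpow :: "complex \<Rightarrow> complex \<Rightarrow> complex" where
  "qpow h b = exp (h * b)"

definition qnum :: "complex \<Rightarrow> complex \<Rightarrow> complex" where
  "qnum h b = (qpow h b - qpow h (- b)) / (qpow h 1 - qpow h (- 1))"

text \<open>Words form the free monoid. It is written additively because the convolution product on
  finitely supported functions is defined for keys in the class \<open>monoid_add\<close>, which is not
  assumed commutative.\<close>

datatype 'a word = Word (letters: "'a list")

instantiation word :: (type) monoid_add
begin

definition zero_word :: "'a word" where
  "0 = Word []"

definition plus_word :: "'a word \<Rightarrow> 'a word \<Rightarrow> 'a word" where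
  "u + v = Word (letters u @ letters v)"

instance
  by standard (simp_all add: zero_word_def plus_word_def)

end

datatype gen = G21 | G32

text \<open>The free unital complex algebra on the two generators: its underlying ring is the type
  \<open>free_alg\<close> with convolution.\<close>

type_synonym free_alg = "gen word \<Rightarrow>\<^sub>0 complex"

abbreviation free_ring :: "free_alg ring" where
  "free_ring \<equiv> ring_of_type_algebra"

definition scale :: "complex \<Rightarrow> ('a \<Rightarrow>\<^sub>0 complex) \<Rightarrow> ('a \<Rightarrow>\<^sub>0 complex)" where
  "scale c x = Poly_Mapping.map (\<lambda>z. c * z) x"

lemma lookup_scale [simp]: "Poly_Mapping.lookup (scale c x) k = c * Poly_Mapping.lookup x k"
  by (simp add: scale_def map.rep_eq when_def)

definition gen21 :: free_alg where
  "gen21 = Poly_Mapping.single (Word [G21]) 1"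

definition gen32 :: free_alg where
  "gen32 = Poly_Mapping.single (Word [G32]) 1"

definition uq_relators :: "complex \<Rightarrow> free_alg set" where
  "uq_relators h =
    {gen32 * gen32 * gen21 - scale (qnum h 2) (gen32 * gen21 * gen32) + gen21 * gen32 * gen32
       + gen21,
     gen21 * gen21 * gen32 - scale (qnum h 2) (gen21 * gen32 * gen21) + gen32 * gen21 * gen21
       + gen32}"

definition uq_ideal :: "complex \<Rightarrow> free_alg set" where
  "uq_ideal h = genideal free_ring (uq_relators h)"

definition Uq :: "complex \<Rightarrow> free_alg set ring" where
  "Uq h = free_ring Quot (uq_ideal h)"

definition uq_class :: "complex \<Rightarrow> free_alg \<Rightarrow> free_alg set" where
  "uq_class h x = uq_ideal h +>\<^bsub>free_ring\<^esub> x"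

definition I21 :: "complex \<Rightarrow> free_alg set" where
  "I21 h = uq_class h gen21"

definition I32 :: "complex \<Rightarrow> free_alg set" where
  "I32 h = uq_class h gen32"

lemma ring_free: "ring free_ring"
proof -
  have "\<exists>y. x + y = 0" for x :: free_alg
    using add.right_inverse by blast
  then show ?thesis
    unfolding ring_of_type_algebra_def using add.right_inverse
    by unfold_locales (auto simp: algebra_simps Units_def)
qed

lemma uq_ideal_ideal: "ideal (uq_ideal h) free_ring"
  unfolding uq_ideal_def
  by (rule ring.genideal_ideal[OF ring_free])
     (simp add: ring_of_type_algebra_def)

lemma ring_Uq: "ring (Uq h)"
  unfolding Uq_def by (rule ideal.quotient_is_ring[OF uq_ideal_ideal])

text \<open>Endomorphisms of a subspace \<open>W\<close> are maps restricted to \<open>W\<close> in the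
  sense of \<^term>\<open>extensional\<close>, so that equality of endomorphisms is equality on
  \<open>W\<close>.\<close>

definition End_ring :: "('a \<Rightarrow>\<^sub>0 complex) set \<Rightarrow> (('a \<Rightarrow>\<^sub>0 complex) \<Rightarrow> ('a \<Rightarrow>\<^sub>0 complex)) ring" where
  "End_ring W =
    \<lparr>carrier = {f \<in> W \<rightarrow>\<^sub>E W. (\<forall>v\<in>W. \<forall>w\<in>W. f (v + w) = f v + f w) \<and>
                           (\<forall>c. \<forall>v\<in>W. f (scale c v) = scale c (f v))},
     monoid.mult = (\<lambda>f g. compose W f g),
     one = restrict id W,
     zero = restrict (\<lambda>_. 0) W,
     add = (\<lambda>f g. restrict (\<lambda>v. f v + g v) W)\<rparr>"

text \<open>A representation on \<open>W\<close> is a unital homomorphism of complex algebras to the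
  endomorphisms of \<open>W\<close>; the scalar action on the quotient is \<open>c [x] = [c x]\<close>.\<close>

definition uq_representation ::
  "complex \<Rightarrow> ('a \<Rightarrow>\<^sub>0 complex) set \<Rightarrow>
    (free_alg set \<Rightarrow> ('a \<Rightarrow>\<^sub>0 complex) \<Rightarrow> ('a \<Rightarrow>\<^sub>0 complex)) \<Rightarrow> bool" where
  "uq_representation h W \<rho> \<longleftrightarrow>
     \<rho> \<in> ring_hom (Uq h) (End_ring W) \<and>
     (\<forall>c x. \<forall>v\<in>W. \<rho> (uq_class h (scale c x)) v = scale c (\<rho> (uq_class h x) v))"

definition shifts :: "complex \<Rightarrow> complex set" where
  "shifts m0 = {m0 + k | k. k \<in> \<int>}"

definition V :: "complex \<Rightarrow> (complex \<Rightarrow>\<^sub>0 complex) set" where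
  "V m0 = {v. Poly_Mapping.keys v \<subseteq> shifts m0}"

definition ket :: "complex \<Rightarrow> (complex \<Rightarrow>\<^sub>0 complex)" where
  "ket m = Poly_Mapping.single m 1"

lemma V_zero: "0 \<in> V m0"
  by (simp add: V_def)

lemma V_add: "v \<in> V m0 \<Longrightarrow> w \<in> V m0 \<Longrightarrow> v + w \<in> V m0"
  unfolding V_def using Poly_Mapping.keys_add[of v w] by blast

lemma V_scale: "v \<in> V m0 \<Longrightarrow> scale c v \<in> V m0"
  by (auto simp: V_def in_keys_iff subset_iff)

lemma V_ket: "m \<in> shifts m0 \<Longrightarrow> ket m \<in> V m0"
  by (simp add: V_def ket_def)

lemma scale_add_right: "scale c (v + w) = scale c v + scale c w"
  by (rule poly_mapping_eqI) (simp add: lookup_add algebra_simps)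

lemma scale_scale: "scale c (scale d v) = scale (c * d) v"
  by (rule poly_mapping_eqI) (simp add: algebra_simps)

lemma scale_zero_right [simp]: "scale c 0 = 0"
  by (rule poly_mapping_eqI) simp

lemma ring_End_V: "ring (End_ring (V m0))"
proof (rule ringI)
  let ?E = "End_ring (V m0)"
  have uminus: "- v = scale (- 1) v" for v :: "complex \<Rightarrow>\<^sub>0 complex"
    by (rule poly_mapping_eqI) simp
  note defs = End_ring_def compose_def PiE_iff extensional_def restrict_def
  show "abelian_group ?E"
  proof (rule abelian_groupI)
    fix f assume f: "f \<in> carrier ?E"
    let ?g = "restrict (\<lambda>v. scale (- 1) (f v)) (V m0)"
    have "?g \<in> carrier ?E"
      using f by (auto simp: defs V_add V_scale scale_add_right scale_scale mult.commute)
    moreover have "?g \<oplus>\<^bsub>?E\<^esub> f = \<zero>\<^bsub>?E\<^esub>"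
      using f by (auto simp: defs uminus[symmetric])
    ultimately show "\<exists>g\<in>carrier ?E. g \<oplus>\<^bsub>?E\<^esub> f = \<zero>\<^bsub>?E\<^esub>"
      by blast
  qed (auto simp: defs V_add V_zero V_scale scale_add_right algebra_simps fun_eq_iff)
  show "monoid ?E"
    by (rule monoidI) (auto simp: defs V_add V_scale fun_eq_iff)
qed (auto simp: End_ring_def compose_def PiE_iff extensional_def restrict_def V_add fun_eq_iff)

end

theory Submission
  imports Defs
begin

text \<open>A representation of an algebra given by generators and relations is the same thing as a choice
  of operators for the generators that satisfy the relations. So the theorem splits into
  this correspondence and a computation.

  Two linear operators make the free algebra act: a word acts by composing
  letters, and the action is extended linearly (\<open>act_mult\<close>, \<open>act_hom\<close>). If both operators
  preserve the subspace and the two relators act on it by zero, the kernel of the action is an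
  ideal containing the relators, hence the ideal that they generate, and the action descends to the
  quotient (\<open>representation_of_operators\<close>). Uniqueness holds because a linear endomorphism is
  determined by the kets, and classes of words span the quotient (\<open>representation_eqI\<close>).

  For the computation, write \<open>A m\<close> for the coefficient of \<open>ket (m + 1)\<close> in the image of
  \<open>ket m\<close> under the second operator, and \<open>D m\<close> for \<open>q^m + q^(- m)\<close>. The first operator is
  diagonal and the second is tridiagonal without diagonal part. So the relation quadratic in
  \<open>I21\<close> concerns only the coefficients of \<open>ket (m + 1)\<close> and \<open>ket (m - 1)\<close>, and there it
  is the identity \<open>[m]^2 - [2][m][m + 1] + [m + 1]^2 = 1\<close>, for every choice of \<open>A\<close>. In the
  relation quadratic in \<open>I32\<close> the coefficients of \<open>ket (m + 2)\<close> and \<open>ket (m - 2)\<close>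
  vanish by the recurrence \<open>[2][m + 1] = [m] + [m + 2]\<close>, and only the diagonal coefficient
  constrains \<open>A\<close>: since \<open>[m + 2] - [m] = D (m + 1)\<close>, it says
  \<open>A m D (m + 1) - A (m - 1) D (m - 1) = - [m]\<close>. For the given \<open>A\<close> one factor of each
  denominator cancels and the common denominator \<open>D m\<close> remains, so the claim becomes
  \<open>[l + m + 1][l - m] - [l + m][l - m + 1] = - [m] D m\<close>, which is \<open>qnum_telescope\<close>.\<close>

section \<open>Linear maps between spaces with a basis\<close>

lemma scale_add_left: "scale (c + d) x = scale c x + scale d x"
  by (rule poly_mapping_eqI) (simp add: lookup_add algebra_simps)

lemma scale_zero_left [simp]: "scale 0 x = 0"
  by (rule poly_mapping_eqI) simp

lemma scale_one [simp]: "scale 1 x = x"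
  by (rule poly_mapping_eqI) simp

lemma scale_minus_one: "scale (- 1) x = - x"
  by (rule poly_mapping_eqI) simp

lemma scale_sum: "scale c (sum f A) = (\<Sum>a\<in>A. scale c (f a))"
  by (rule poly_mapping_eqI) (simp add: lookup_sum sum_distrib_left)

lemma scale_single [simp]: "scale c (Poly_Mapping.single k d) = Poly_Mapping.single k (c * d)"
  by (rule poly_mapping_eqI) (simp add: lookup_single when_def)

text \<open>Every finitely supported function is a finite linear combination of basis vectors from its
  support. Tracking the support through the induction makes the rule applicable to the subspace
  \<open>V m0\<close> as well as to whole spaces.\<close>

lemma combination_induct [consumes 1, case_names zero add basis]:
  fixes x :: "'a \<Rightarrow>\<^sub>0 complex"
  assumes "Poly_Mapping.keys x \<subseteq> S"
    and zero: "P 0"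
    and add: "\<And>x y. Poly_Mapping.keys x \<subseteq> S \<Longrightarrow> Poly_Mapping.keys y \<subseteq> S \<Longrightarrow> P x \<Longrightarrow> P y \<Longrightarrow> P (x + y)"
    and basis: "\<And>c k. k \<in> S \<Longrightarrow> P (scale c (Poly_Mapping.single k 1))"
  shows "P x"
proof -
  let ?s = "\<lambda>A. \<Sum>k\<in>A. scale (Poly_Mapping.lookup x k) (Poly_Mapping.single k 1)"
  have "Poly_Mapping.keys (?s A) \<subseteq> S \<and> P (?s A)" if "finite A" "A \<subseteq> Poly_Mapping.keys x" for A
    using that
  proof (induction A)
    case empty
    show ?case by (simp add: zero)
  next
    case (insert k A)
    let ?b = "scale (Poly_Mapping.lookup x k) (Poly_Mapping.single k 1)"
    have kS: "k \<in> S"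
      using insert.prems assms(1) by blast
    then have b: "Poly_Mapping.keys ?b \<subseteq> S"
      by simp
    have IH: "Poly_Mapping.keys (?s A) \<subseteq> S" "P (?s A)"
      using insert by simp_all
    have "Poly_Mapping.keys (?b + ?s A) \<subseteq> S"
      using Poly_Mapping.keys_add[of ?b "?s A"] b IH(1) by blast
    moreover have "P (?b + ?s A)"
      by (rule add[OF b IH(1) basis[OF kS] IH(2)])
    ultimately show ?case
      using insert.hyps by simp
  qed
  moreover have "?s (Poly_Mapping.keys x) = x"
    by (rule poly_mapping_eqI)
       (simp add: lookup_sum lookup_single when_def in_keys_iff)
  ultimately show ?thesis
    by (metis finite_keys subset_refl)
qed

text \<open>The instance without a condition on the support; it is used for elements of the free algebra,
  where the basis consists of all words.\<close>

lemma linear_induct [case_names zero add basis]: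
  fixes x :: "'a \<Rightarrow>\<^sub>0 complex"
  assumes "P 0" "\<And>x y. P x \<Longrightarrow> P y \<Longrightarrow> P (x + y)"
    "\<And>c k. P (scale c (Poly_Mapping.single k 1))"
  shows "P x"
  using subset_UNIV by (induction x rule: combination_induct) (use assms in auto)

definition linear_map :: "(('a \<Rightarrow>\<^sub>0 complex) \<Rightarrow> ('b \<Rightarrow>\<^sub>0 complex)) \<Rightarrow> bool" where
  "linear_map f \<longleftrightarrow> (\<forall>x y. f (x + y) = f x + f y) \<and> (\<forall>c x. f (scale c x) = scale c (f x))"

lemma linear_mapD:
  assumes "linear_map f"
  shows "f (x + y) = f x + f y" "f (scale c x) = scale c (f x)" "f 0 = 0" "f (- x) = - f x"
    "f (x - y) = f x - f y"
proof -
  show add: "f (x + y) = f x + f y" and scale: "f (scale c x) = scale c (f x)" for x y c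
    using assms by (auto simp: linear_map_def)
  show "f 0 = 0"
    using add[of 0 0] by simp
  show minus: "f (- x) = - f x" for x
    using scale[of "- 1" x] by (simp add: scale_minus_one)
  show "f (x - y) = f x - f y"
    using add[of x "- y"] minus[of y] by simp
qed

definition lin_ext :: "('a \<Rightarrow> ('b \<Rightarrow>\<^sub>0 complex)) \<Rightarrow> ('a \<Rightarrow>\<^sub>0 complex) \<Rightarrow> ('b \<Rightarrow>\<^sub>0 complex)" where
  "lin_ext f x = (\<Sum>k\<in>Poly_Mapping.keys x. scale (Poly_Mapping.lookup x k) (f k))"

text \<open>Summing over a larger finite set than the support allows the sums for \<open>x\<close>, \<open>y\<close> and
  \<open>x + y\<close> to be compared, whose supports differ.\<close>

lemma lin_ext_superset:
  assumes "finite A" "Poly_Mapping.keys x \<subseteq> A"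
  shows "lin_ext f x = (\<Sum>k\<in>A. scale (Poly_Mapping.lookup x k) (f k))"
  unfolding lin_ext_def using assms
  by (intro sum.mono_neutral_left) (auto simp: in_keys_iff)

lemma lin_ext_linear: "linear_map (lin_ext f)"
  unfolding linear_map_def
proof (intro conjI allI)
  fix x y :: "'a \<Rightarrow>\<^sub>0 complex" and c
  let ?A = "Poly_Mapping.keys x \<union> Poly_Mapping.keys y"
  have "lin_ext f (x + y) = (\<Sum>k\<in>?A. scale (Poly_Mapping.lookup (x + y) k) (f k))"
    by (rule lin_ext_superset) (simp_all add: Poly_Mapping.keys_add)
  also have "\<dots> = lin_ext f x + lin_ext f y"
    by (simp add: lin_ext_superset[of ?A x] lin_ext_superset[of ?A y]
        lookup_add scale_add_left sum.distrib)
  finally show "lin_ext f (x + y) = lin_ext f x + lin_ext f y" .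
  have "lin_ext f (scale c x)
      = (\<Sum>k\<in>Poly_Mapping.keys x. scale (Poly_Mapping.lookup (scale c x) k) (f k))"
    by (rule lin_ext_superset) (auto simp: in_keys_iff)
  then show "lin_ext f (scale c x) = scale c (lin_ext f x)"
    by (simp add: lin_ext_def scale_sum scale_scale)
qed

lemma lin_ext_single [simp]: "lin_ext f (Poly_Mapping.single k 1) = f k"
  by (simp add: lin_ext_def)

section \<open>The free algebra acting through two operators\<close>

text \<open>The operators are total functions on the whole space of finitely supported functions, so that
  composition along a word needs no domain conditions; invariant subspaces enter only later.\<close>

definition act :: "(gen \<Rightarrow> ('b \<Rightarrow>\<^sub>0 complex) \<Rightarrow> ('b \<Rightarrow>\<^sub>0 complex)) \<Rightarrow> free_alg \<Rightarrow>
    ('b \<Rightarrow>\<^sub>0 complex) \<Rightarrow> ('b \<Rightarrow>\<^sub>0 complex)" where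
  "act T x v = lin_ext (\<lambda>w. foldr T (letters w) v) x"

lemma act_add_left: "act T (x + y) v = act T x v + act T y v"
  and act_scale_left: "act T (scale c x) v = scale c (act T x v)"
  and act_zero_left: "act T 0 v = 0"
  and act_diff_left: "act T (x - y) v = act T x v - act T y v"
  unfolding act_def by (rule linear_mapD[OF lin_ext_linear])+

lemma act_word: "act T (Poly_Mapping.single w 1) v = foldr T (letters w) v"
  by (simp add: act_def)

lemma act_one: "act T 1 v = v"
  using act_word[of T 0 v] by (simp add: zero_word_def[symmetric]) (simp add: zero_word_def)

lemma act_gens: "act T gen21 v = T G21 v" "act T gen32 v = T G32 v"
  by (simp_all add: gen21_def gen32_def act_word)

lemma foldr_linear: "(\<And>g. linear_map (T g)) \<Longrightarrow> linear_map (foldr T gs)"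
  by (induction gs) (auto simp: linear_map_def)

lemma act_linear:
  assumes "\<And>g. linear_map (T g)"
  shows "linear_map (act T x)"
proof -
  have "linear_map (foldr T gs)" for gs
    by (rule foldr_linear) (rule assms)
  then show ?thesis
    unfolding linear_map_def act_def lin_ext_def
    by (auto simp: sum.distrib scale_add_right scale_sum scale_scale mult.commute)
qed

text \<open>The free algebra carries its scalar action only through \<open>scale\<close>. That it is compatible with
  the convolution product follows because scaling by \<open>c\<close> is multiplication, on either side, by
  \<open>c\<close> times the empty word.\<close>

lemma scale_mult_left: "scale c x * y = scale c (x * y)" for x y :: free_alg
proof -
  have eq: "scale c x = Poly_Mapping.single 0 c * x" for x :: free_alg
  proof (induction x rule: linear_induct)
    case (add x y)
    then show ?case by (simp add: scale_add_right distrib_left)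
  next
    case (basis d k)
    show ?case by (simp add: mult_single)
  qed simp_all
  show ?thesis
    by (simp add: eq mult.assoc)
qed

lemma scale_mult_right: "x * scale c y = scale c (x * y)" for x y :: free_alg
proof -
  have eq: "scale c x = x * Poly_Mapping.single 0 c" for x :: free_alg
  proof (induction x rule: linear_induct)
    case (add x y)
    then show ?case by (simp add: scale_add_right distrib_right)
  next
    case (basis d k)
    show ?case by (simp add: mult_single mult.commute)
  qed simp_all
  show ?thesis
    by (simp add: eq mult.assoc)
qed

text \<open>Both sides are bilinear in \<open>x\<close> and \<open>y\<close>, and for two words the claim is that
  folding over a concatenation is composition. Linearity of the operators is what makes the right-hand
  side linear in \<open>y\<close>.\<close>

lemma act_mult:
  assumes T: "\<And>g. linear_map (T g)"
  shows "act T (x * y) v = act T x (act T y v)"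
proof (induction x rule: linear_induct)
  case (add x x')
  then show ?case by (simp add: distrib_right act_add_left)
next
  case (basis c w)
  have "act T (Poly_Mapping.single w 1 * y) v = foldr T (letters w) (act T y v)"
  proof (induction y rule: linear_induct)
    case (add y y')
    then show ?case
      by (simp add: distrib_left act_add_left linear_mapD(1)[OF foldr_linear[OF T]])
  next
    case (basis d u)
    have "act T (Poly_Mapping.single w 1 * Poly_Mapping.single u 1) v
        = foldr T (letters w) (act T (Poly_Mapping.single u 1) v)"
      by (simp add: mult_single act_word plus_word_def)
    then show ?case
      unfolding scale_mult_right act_scale_left by (simp add: linear_mapD(2)[OF foldr_linear[OF T]])
  qed (simp_all add: act_zero_left linear_mapD(3)[OF foldr_linear[OF T]])
  then show ?case
    unfolding scale_mult_left act_scale_left by (simp add: act_word)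
qed (simp_all add: act_zero_left)

section \<open>Representations of the quotient\<close>

lemma free_ring_simps [simp]:
  "carrier free_ring = UNIV" "monoid.mult free_ring = (*)" "one free_ring = 1" "add free_ring = (+)"
  "zero free_ring = 0"
  by (simp_all add: ring_of_type_algebra_def)

lemma carrier_Uq: "carrier (Uq h) = range (uq_class h)"
  by (auto simp: Uq_def FactRing_def A_RCOSETS_def' uq_class_def)

lemma uq_class_eq_image: "uq_class h x = (\<lambda>u. u + x) ` uq_ideal h"
  by (auto simp: uq_class_def a_r_coset_def')

lemma uq_class_hom: "uq_class h \<in> ring_hom free_ring (Uq h)"
  unfolding Uq_def using ideal.rcos_ring_hom[OF uq_ideal_ideal]
  by (simp add: uq_class_def[abs_def])

lemma uq_class_add: "uq_class h (x + y) = uq_class h x \<oplus>\<^bsub>Uq h\<^esub> uq_class h y"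
  and uq_class_mult: "uq_class h (x * y) = uq_class h x \<otimes>\<^bsub>Uq h\<^esub> uq_class h y"
  and uq_class_one: "uq_class h 1 = \<one>\<^bsub>Uq h\<^esub>"
  using ring_hom_add[OF uq_class_hom, of x y] ring_hom_mult[OF uq_class_hom, of x y]
    ring_hom_one[OF uq_class_hom] by simp_all

lemma End_ring_mult: "v \<in> W \<Longrightarrow> (f \<otimes>\<^bsub>End_ring W\<^esub> g) v = f (g v)"
  and End_ring_add: "v \<in> W \<Longrightarrow> (f \<oplus>\<^bsub>End_ring W\<^esub> g) v = f v + g v"
  and End_ring_one: "v \<in> W \<Longrightarrow> \<one>\<^bsub>End_ring W\<^esub> v = v"
  by (simp_all add: End_ring_def compose_def)

lemma act_V:
  assumes inv: "\<And>g v. v \<in> V m0 \<Longrightarrow> T g v \<in> V m0" and v: "v \<in> V m0"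
  shows "act T x v \<in> V m0"
proof (induction x rule: linear_induct)
  case (basis c w)
  have "foldr T gs v \<in> V m0" for gs
    by (induction gs) (simp_all add: inv v)
  then show ?case
    unfolding act_scale_left act_word by (rule V_scale)
qed (simp_all add: act_add_left act_zero_left V_add V_zero)

lemma act_hom:
  assumes T: "\<And>g. linear_map (T g)" and inv: "\<And>g v. v \<in> V m0 \<Longrightarrow> T g v \<in> V m0"
  shows "(\<lambda>x. restrict (act T x) (V m0)) \<in> ring_hom free_ring (End_ring (V m0))"
proof (rule ring_hom_memI)
  note lin = linear_mapD(1,2)[OF act_linear[OF T]]
  have V: "act T x v \<in> V m0" if "v \<in> V m0" for x v
    by (rule act_V) (use that inv in auto)
  show "restrict (act T x) (V m0) \<in> carrier (End_ring (V m0))" for x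
    by (auto simp: End_ring_def V V_add V_scale lin)
  show "restrict (act T (x \<otimes>\<^bsub>free_ring\<^esub> y)) (V m0)
      = restrict (act T x) (V m0) \<otimes>\<^bsub>End_ring (V m0)\<^esub> restrict (act T y) (V m0)" for x y
    by (auto simp: End_ring_def compose_def V fun_eq_iff act_mult[OF T])
  show "restrict (act T (x \<oplus>\<^bsub>free_ring\<^esub> y)) (V m0)
      = restrict (act T x) (V m0) \<oplus>\<^bsub>End_ring (V m0)\<^esub> restrict (act T y) (V m0)" for x y
    by (auto simp: End_ring_def fun_eq_iff act_add_left)
  show "restrict (act T \<one>\<^bsub>free_ring\<^esub>) (V m0) = \<one>\<^bsub>End_ring (V m0)\<^esub>"
    by (auto simp: End_ring_def fun_eq_iff act_one)
qed

text \<open>The universal property of the presentation: the kernel of the action is a two-sided ideal, so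
  it contains \<open>uq_ideal h\<close> as soon as it contains the relators. The action is then constant on
  each class, and its value there can be read off as the only element of the image of the class.\<close>

lemma representation_of_operators:
  assumes T: "\<And>g. linear_map (T g)" and inv: "\<And>g v. v \<in> V m0 \<Longrightarrow> T g v \<in> V m0"
    and rel: "\<And>r v. r \<in> uq_relators h \<Longrightarrow> v \<in> V m0 \<Longrightarrow> act T r v = 0"
  obtains \<rho> where "\<rho> \<in> extensional (carrier (Uq h))" "uq_representation h (V m0) \<rho>"
    "\<And>x v. v \<in> V m0 \<Longrightarrow> \<rho> (uq_class h x) v = act T x v"
proof -
  let ?E = "End_ring (V m0)"
  define \<phi> where "\<phi> = (\<lambda>x. restrict (act T x) (V m0))"
  have hom: "\<phi> \<in> ring_hom free_ring ?E"
    unfolding \<phi>_def using T inv by (rule act_hom)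
  interpret \<phi>: ring_hom_ring free_ring ?E \<phi>
    by (rule ring_hom_ringI2[OF ring_free ring_End_V hom])
  have kernel: "uq_ideal h \<subseteq> a_kernel free_ring ?E \<phi>"
    unfolding uq_ideal_def
  proof (rule ring.genideal_minimal[OF ring_free \<phi>.kernel_is_ideal])
    show "uq_relators h \<subseteq> a_kernel free_ring ?E \<phi>"
      by (auto simp: a_kernel_def' \<phi>_def End_ring_def rel fun_eq_iff)
  qed
  have im: "\<phi> ` uq_class h x = {\<phi> x}" for x
  proof -
    have "\<phi> (u + x) = \<phi> x" if "u \<in> uq_ideal h" for u
    proof -
      have "\<phi> u = \<zero>\<^bsub>?E\<^esub>"
        using subsetD[OF kernel that] unfolding a_kernel_def' by blast
      then have "\<phi> (u + x) = \<zero>\<^bsub>?E\<^esub> \<oplus>\<^bsub>?E\<^esub> \<phi> x"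
        using ring_hom_add[OF hom, of u x, unfolded free_ring_simps, OF UNIV_I UNIV_I] by metis
      also have "\<dots> = \<phi> x"
        by (intro \<phi>.S.l_zero ring_hom_closed[OF hom]) (unfold free_ring_simps, rule UNIV_I)
      finally show ?thesis .
    qed
    moreover have "uq_ideal h \<noteq> {}"
      using additive_subgroup.zero_closed[OF ideal.axioms(1)[OF uq_ideal_ideal]] by blast
    ultimately show ?thesis
      unfolding uq_class_eq_image image_image by auto
  qed
  define \<rho> where "\<rho> = restrict (\<lambda>C. the_elem (\<phi> ` C)) (carrier (Uq h))"
  have \<rho>: "\<rho> (uq_class h x) = \<phi> x" for x
    by (simp add: \<rho>_def carrier_Uq im)
  have "\<rho> \<in> ring_hom (Uq h) ?E"
  proof (rule ring_hom_memI)
    show "\<rho> \<one>\<^bsub>Uq h\<^esub> = \<one>\<^bsub>?E\<^esub>"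
      using ring_hom_one[OF hom] by (simp add: uq_class_one[symmetric] \<rho>)
  qed (use ring_hom_closed[OF hom] ring_hom_add[OF hom] ring_hom_mult[OF hom] in
      \<open>auto simp: carrier_Uq \<rho> simp flip: uq_class_add uq_class_mult\<close>)
  moreover have "\<rho> (uq_class h x) v = act T x v" if "v \<in> V m0" for x v
    using that by (simp add: \<rho> \<phi>_def)
  moreover have "\<rho> \<in> extensional (carrier (Uq h))"
    by (simp add: \<rho>_def)
  ultimately show thesis
    by (intro that[of \<rho>]) (auto simp: uq_representation_def act_scale_left)
qed

text \<open>The extensionality built into the endomorphism ring turns equality on the subspace into
  equality of functions.\<close>

lemma endomorphism_eqI:
  assumes f: "f \<in> carrier (End_ring (V m0))" and g: "g \<in> carrier (End_ring (V m0))"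
    and ket: "\<And>m. m \<in> shifts m0 \<Longrightarrow> f (ket m) = g (ket m)"
  shows "f = g"
proof (rule PiE_ext)
  show "f \<in> V m0 \<rightarrow>\<^sub>E V m0" "g \<in> V m0 \<rightarrow>\<^sub>E V m0"
    using f g by (auto simp: End_ring_def)
  have scale: "F (scale c v) = scale c (F v)" if "F \<in> carrier (End_ring (V m0))" "v \<in> V m0" for F c v
    using that by (simp add: End_ring_def)
  have additive: "F (v + w) = F v + F w" if "F \<in> carrier (End_ring (V m0))" "v \<in> V m0" "w \<in> V m0" for F v w
    using that by (simp add: End_ring_def)
  have "F 0 = 0" if "F \<in> carrier (End_ring (V m0))" for F
    using scale[OF that V_zero, of 0] by simp
  then have zero: "f 0 = g 0"
    using f g by metis
  fix v assume "v \<in> V m0"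
  then have "Poly_Mapping.keys v \<subseteq> shifts m0"
    by (simp add: V_def)
  then show "f v = g v"
  proof (induction v rule: combination_induct)
    case (add v w)
    then have "v \<in> V m0" "w \<in> V m0"
      by (simp_all add: V_def)
    then show ?case
      using add.IH additive f g by metis
  next
    case (basis c m)
    then show ?case
      using ket[of m] scale[OF f V_ket] scale[OF g V_ket] by (simp add: ket_def del: scale_single)
  qed (rule zero)
qed

text \<open>Agreement spreads from the generators to words by multiplicativity, and from words to all
  classes by additivity and compatibility with scalars. The equality of \<open>\<rho>\<close> and
  \<open>\<sigma>\<close> outside the quotient comes from the extensionality assumptions.\<close>

lemma representation_eqI:
  assumes ext: "\<rho> \<in> extensional (carrier (Uq h))" "\<sigma> \<in> extensional (carrier (Uq h))"
    and rep: "uq_representation h (V m0) \<rho>" "uq_representation h (V m0) \<sigma>"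
    and gens: "\<And>m. m \<in> shifts m0 \<Longrightarrow> \<rho> (I21 h) (ket m) = \<sigma> (I21 h) (ket m)"
      "\<And>m. m \<in> shifts m0 \<Longrightarrow> \<rho> (I32 h) (ket m) = \<sigma> (I32 h) (ket m)"
  shows "\<rho> = \<sigma>"
proof (rule extensionalityI[OF ext])
  let ?E = "End_ring (V m0)"
  have hom: "\<rho> \<in> ring_hom (Uq h) ?E" "\<sigma> \<in> ring_hom (Uq h) ?E"
    using rep by (auto simp: uq_representation_def)
  have carr: "uq_class h x \<in> carrier (Uq h)" for x
    by (simp add: carrier_Uq)
  note closed = ring_hom_closed[OF hom(1) carr] ring_hom_closed[OF hom(2) carr]
  have gen: "\<rho> (I21 h) = \<sigma> (I21 h)" "\<rho> (I32 h) = \<sigma> (I32 h)"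
    unfolding I21_def I32_def
    by (rule endomorphism_eqI[OF closed], fact gens[unfolded I21_def I32_def])+
  have word: "\<rho> (uq_class h (Poly_Mapping.single (Word gs) 1))
      = \<sigma> (uq_class h (Poly_Mapping.single (Word gs) 1))" for gs
  proof (induction gs)
    case Nil
    have "Poly_Mapping.single (Word []) 1 = (1 :: free_alg)"
      unfolding zero_word_def[symmetric] by simp
    then show ?case
      by (simp add: uq_class_one ring_hom_one[OF hom(1)] ring_hom_one[OF hom(2)])
  next
    case (Cons g gs)
    have split: "Poly_Mapping.single (Word (g # gs)) 1
        = Poly_Mapping.single (Word [g]) 1 * (Poly_Mapping.single (Word gs) 1 :: free_alg)"
      by (simp add: mult_single plus_word_def)
    have "\<rho> (uq_class h (Poly_Mapping.single (Word [g]) 1))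
        = \<sigma> (uq_class h (Poly_Mapping.single (Word [g]) 1))"
      using gen by (cases g) (simp_all add: I21_def I32_def gen21_def gen32_def)
    then show ?case
      unfolding split uq_class_mult
      by (simp add: ring_hom_mult[OF hom(1) carr carr] ring_hom_mult[OF hom(2) carr carr] Cons)
  qed
  have scale: "\<tau> (uq_class h (scale c x)) v = scale c (\<tau> (uq_class h x) v)"
    if "uq_representation h (V m0) \<tau>" "v \<in> V m0" for \<tau> c x v
    using that by (simp add: uq_representation_def)
  have zero: "\<tau> (uq_class h 0) v = 0" if "uq_representation h (V m0) \<tau>" "v \<in> V m0" for \<tau> v
    using scale[OF that, of 0 0] by simp
  have additive: "\<tau> (uq_class h (x + y)) v = \<tau> (uq_class h x) v + \<tau> (uq_class h y) v"
    if "\<tau> \<in> ring_hom (Uq h) ?E" "v \<in> V m0" for \<tau> x y v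
    unfolding uq_class_add ring_hom_add[OF that(1) carr carr] by (rule End_ring_add[OF that(2)])
  have eq: "\<rho> (uq_class h x) v = \<sigma> (uq_class h x) v" if v: "v \<in> V m0" for x v
  proof (induction x rule: linear_induct)
    case (add x y)
    then show ?case
      by (simp add: additive[OF hom(1) v] additive[OF hom(2) v])
  next
    case (basis c w)
    show ?case
      using word[of "letters w"]
      by (simp add: scale[OF rep(1) v] scale[OF rep(2) v] del: scale_single)
  qed (simp_all add: zero[OF rep(1) v] zero[OF rep(2) v])
  fix C assume "C \<in> carrier (Uq h)"
  then obtain x where C: "C = uq_class h x"
    by (auto simp: carrier_Uq)
  have PiE: "\<tau> (uq_class h x) \<in> V m0 \<rightarrow>\<^sub>E V m0" if "\<tau> \<in> ring_hom (Uq h) ?E" for \<tau>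
    using ring_hom_closed[OF that carr[of x]] by (simp add: End_ring_def)
  show "\<rho> C = \<sigma> C"
    unfolding C by (rule PiE_ext[OF PiE[OF hom(1)] PiE[OF hom(2)]]) (rule eq)
qed

section \<open>Identities for quantum numbers\<close>

lemma qpow_add: "qpow h (a + b) = qpow h a * qpow h b"
  by (simp add: qpow_def distrib_left exp_add)

lemma qpow_mult_minus: "qpow h b * qpow h (- b) = 1"
  by (simp flip: qpow_add) (simp add: qpow_def)

text \<open>The denominator of the quantum numbers vanishes only if \<open>q\<^sup>2 = 1\<close>, that is, if
  \<open>2 h\<close> is an integer multiple of \<open>2 \<pi> i\<close>.\<close>

lemma q_minus_inverse_nonzero:
  assumes "h \<notin> {2 * of_real pi * \<i> * r | r. r \<in> \<rat>}"
  shows "qpow h 1 - qpow h (- 1) \<noteq> 0"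
proof
  assume "qpow h 1 - qpow h (- 1) = 0"
  then have "qpow h 1 * qpow h 1 = 1"
    using qpow_mult_minus[of h 1] by simp
  then have "exp (2 * h) = 1"
    by (simp only: qpow_def mult_2 exp_add mult_1_right)
  then have "Re (2 * h) = 0" "cos (Im (2 * h)) = 1"
    using norm_exp_eq_Re[of "2 * h"] Re_exp[of "2 * h"] by simp_all
  then obtain n :: int where "Re (2 * h) = 0" "Im (2 * h) = of_int n * 2 * pi"
    by (auto simp: cos_one_2pi_int)
  then have "h = 2 * of_real pi * \<i> * (of_int n / 2)"
    by (simp add: complex_eq_iff)
  moreover have "(of_int n / 2 :: complex) \<in> \<rat>"
    by simp
  ultimately show False
    using assms by blast
qed

definition qden :: "complex \<Rightarrow> complex \<Rightarrow> complex" where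
  "qden h m = qpow h m + qpow h (- m)"

lemma qden_nonzero:
  assumes "qpow h (2 * m) \<noteq> - 1"
  shows "qden h m \<noteq> 0"
proof
  assume "qden h m = 0"
  then have "qpow h m = - qpow h (- m)"
    by (simp add: qden_def eq_neg_iff_add_eq_0)
  then have "qpow h m * qpow h m = - 1"
    using qpow_mult_minus[of h m] by (metis mult_minus_right)
  then show False
    using assms unfolding mult_2 qpow_add by contradiction
qed

text \<open>Each identity for quantum numbers becomes polynomial after clearing the denominator, once a
  power of \<open>q\<close> and its inverse are treated as separate variables whose product is one. The
  next three lemmas are these polynomial identities, with \<open>p\<close>, \<open>y\<close> and \<open>b\<close> in the
  role of the inverses of \<open>q\<close>, \<open>x\<close> and \<open>a\<close>.\<close>

lemma quadratic_identity:
  fixes q :: complex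
  assumes "q * p = 1" "x * y = 1"
  shows "(x - y) * (x - y) - (q + p) * ((x - y) * (x * q - y * p))
    + (x * q - y * p) * (x * q - y * p) = (q - p) * (q - p)"
  \<comment> \<open>Unqualified, the name of this proof method would denote the one for locale-based rings.\<close>
  using assms by Groebner_Basis.algebra

lemma step_identity:
  fixes q :: complex
  assumes "q * p = 1"
  shows "(q + p) * (x * q - y * p) = (x - y) + (x * q * q - y * p * p)"
  using assms by Groebner_Basis.algebra

lemma telescope_identity:
  fixes a :: complex
  assumes "a * b = 1"
  shows "(a * x * q - b * y * p) * (a * y - b * x) - (a * x - b * y) * (a * y * q - b * x * p)
    = - (x - y) * (x + y) * (q - p)"
  using assms by Groebner_Basis.algebra

lemma qnum_cleared:
  assumes "qpow h 1 - qpow h (- 1) \<noteq> 0"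
  shows "qnum h b * (qpow h 1 - qpow h (- 1)) = qpow h b - qpow h (- b)"
  using assms by (simp add: qnum_def)

context
  fixes h :: complex
  assumes s: "qpow h 1 - qpow h (- 1) \<noteq> 0"
begin

lemma qnum_two: "qnum h 2 = qpow h 1 + qpow h (- 1)"
proof -
  have "qpow h 2 = qpow h 1 * qpow h 1" "qpow h (- 2) = qpow h (- 1) * qpow h (- 1)"
    by (simp_all flip: qpow_add)
  then have "qnum h 2 * (qpow h 1 - qpow h (- 1))
      = (qpow h 1 + qpow h (- 1)) * (qpow h 1 - qpow h (- 1))"
    unfolding qnum_cleared[OF s] by (simp add: algebra_simps)
  then show ?thesis
    using s by simp
qed

lemma qpow_step:
  "qpow h (b + 1) = qpow h b * qpow h 1" "qpow h (- (b + 1)) = qpow h (- b) * qpow h (- 1)"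
  unfolding minus_add_distrib by (rule qpow_add)+

lemma qnum_gap: "qnum h (m + 1) - qnum h (m - 1) = qden h m"
proof -
  have "qpow h (m - 1) = qpow h m * qpow h (- 1)" "qpow h (- (m - 1)) = qpow h (- m) * qpow h 1"
    by (simp_all flip: qpow_add)
  then have "(qnum h (m + 1) - qnum h (m - 1)) * (qpow h 1 - qpow h (- 1))
      = qden h m * (qpow h 1 - qpow h (- 1))"
    unfolding left_diff_distrib qnum_cleared[OF s] qden_def qpow_step by (simp add: algebra_simps)
  then show ?thesis
    using s by simp
qed

lemma qnum_step: "qnum h 2 * qnum h (m + 1) = qnum h m + qnum h (m + 2)"
proof -
  let ?s = "qpow h 1 - qpow h (- 1)"
  have two: "m + 2 = m + 1 + 1"
    by simp
  have "qnum h 2 * qnum h (m + 1) * ?s = qnum h 2 * (qnum h (m + 1) * ?s)"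
    by (rule mult.assoc)
  also have "\<dots> = qnum h m * ?s + qnum h (m + 2) * ?s"
    unfolding qnum_cleared[OF s] two qpow_step qnum_two
    by (rule step_identity[OF qpow_mult_minus])
  also have "\<dots> = (qnum h m + qnum h (m + 2)) * ?s"
    by (rule distrib_right[symmetric])
  finally show ?thesis
    using s by simp
qed

text \<open>This relation between consecutive quantum numbers is what produces the right-hand side
  \<open>- I32\<close> in the relation quadratic in \<open>I21\<close>.\<close>

lemma qnum_quadratic:
  "qnum h m * qnum h m - qnum h 2 * (qnum h m * qnum h (m + 1)) + qnum h (m + 1) * qnum h (m + 1) = 1"
proof -
  let ?s = "qpow h 1 - qpow h (- 1)"
  have clear: "(a * a - c * (a * b) + b * b) * (t * t)
      = (a * t) * (a * t) - c * ((a * t) * (b * t)) + (b * t) * (b * t)" for a b c t :: complex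
    by (simp add: algebra_simps)
  have "(qnum h m * qnum h m - qnum h 2 * (qnum h m * qnum h (m + 1))
      + qnum h (m + 1) * qnum h (m + 1)) * (?s * ?s) = ?s * ?s"
    unfolding clear qnum_cleared[OF s] qpow_step qnum_two
    by (rule quadratic_identity[OF qpow_mult_minus qpow_mult_minus])
  then show ?thesis
    using s by simp
qed

text \<open>The left-hand side is the difference at \<open>m\<close> and \<open>m - 1\<close> of the function
  \<open>[l + m + 1][l - m]\<close>, the numerator of the coefficient of \<open>ket (m + 1)\<close>. The number
  \<open>l\<close> drops out of this difference, and therefore it can be arbitrary in the theorem.\<close>

lemma qnum_telescope:
  "qnum h (l + m + 1) * qnum h (l - m) - qnum h (l + m) * qnum h (l - m + 1) = - qnum h m * qden h m"
proof -
  let ?s = "qpow h 1 - qpow h (- 1)"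
  have split: "qpow h (l + m) = qpow h l * qpow h m" "qpow h (- (l + m)) = qpow h (- l) * qpow h (- m)"
    "qpow h (l - m) = qpow h l * qpow h (- m)" "qpow h (- (l - m)) = qpow h (- l) * qpow h m"
    by (simp_all flip: qpow_add)
  have clear: "(a * b - c * d) * (t * t) = (a * t) * (b * t) - (c * t) * (d * t)"
    for a b c d t :: complex
    by (simp add: algebra_simps)
  have "(qnum h (l + m + 1) * qnum h (l - m) - qnum h (l + m) * qnum h (l - m + 1)) * (?s * ?s)
      = - (qnum h m * ?s) * qden h m * ?s"
    unfolding clear qnum_cleared[OF s] qpow_step split qden_def
    by (rule telescope_identity[OF qpow_mult_minus])
  also have "\<dots> = - qnum h m * qden h m * (?s * ?s)"
    by (simp add: algebra_simps)
  finally show ?thesis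
    using s unfolding mult_cancel_right by simp
qed

end

section \<open>The two operators\<close>

definition up_coeff :: "complex \<Rightarrow> complex \<Rightarrow> complex \<Rightarrow> complex" where
  "up_coeff h l m = qnum h (l + m + 1) * qnum h (l - m) / (qden h m * qden h (m + 1))"

text \<open>The formulas are extended linearly from all kets, also from those outside \<open>V m0\<close>, where
  a denominator may vanish and the coefficient is then zero by convention. This keeps the operators
  linear on the whole space; the relations are claimed on \<open>V m0\<close> only.\<close>

definition gen_op :: "complex \<Rightarrow> complex \<Rightarrow> gen \<Rightarrow> (complex \<Rightarrow>\<^sub>0 complex) \<Rightarrow> (complex \<Rightarrow>\<^sub>0 complex)" where
  "gen_op h l g = (case g of
     G21 \<Rightarrow> lin_ext (\<lambda>m. scale (\<i> * qnum h m) (ket m))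
   | G32 \<Rightarrow> lin_ext (\<lambda>m. scale (up_coeff h l m) (ket (m + 1)) - ket (m - 1)))"

lemma gen_op_linear: "linear_map (gen_op h l g)"
  by (cases g) (simp_all add: gen_op_def lin_ext_linear)

lemma gen_op_ket:
  "gen_op h l G21 (ket m) = scale (\<i> * qnum h m) (ket m)"
  "gen_op h l G32 (ket m) = scale (up_coeff h l m) (ket (m + 1)) - ket (m - 1)"
  by (simp_all add: gen_op_def ket_def[of m])

lemma shifts_step:
  assumes "m \<in> shifts m0"
  shows "m + 1 \<in> shifts m0" "m - 1 \<in> shifts m0"
proof -
  obtain k where k: "k \<in> \<int>" "m = m0 + k"
    using assms by (auto simp: shifts_def)
  then have "k + 1 \<in> \<int>" "m + 1 = m0 + (k + 1)" "k - 1 \<in> \<int>" "m - 1 = m0 + (k - 1)"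
    by simp_all
  then show "m + 1 \<in> shifts m0" "m - 1 \<in> shifts m0"
    unfolding shifts_def by blast+
qed

lemma V_minus: "v \<in> V m0 \<Longrightarrow> - v \<in> V m0"
  using V_scale[of v m0 "- 1"] by (simp add: scale_minus_one)

lemma gen_op_V:
  assumes "v \<in> V m0"
  shows "gen_op h l g v \<in> V m0"
proof -
  have "Poly_Mapping.keys v \<subseteq> shifts m0"
    using assms by (simp add: V_def)
  then show ?thesis
  proof (induction v rule: combination_induct)
    case (basis c m)
    have "gen_op h l g (ket m) \<in> V m0"
      using basis V_add[OF V_scale[OF V_ket] V_minus[OF V_ket], of "m + 1" m0 "m - 1"]
      by (cases g) (simp_all add: gen_op_ket V_scale V_ket shifts_step)
    then show ?case
      unfolding linear_mapD(2)[OF gen_op_linear] ket_def by (rule V_scale)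
  qed (simp_all add: linear_mapD[OF gen_op_linear] V_zero V_add)
qed

text \<open>The diagonal coefficient of the relation quadratic in \<open>I32\<close>, reduced to the difference
  equation for \<open>A\<close>. The letters stand for quantum numbers: \<open>n\<close> for \<open>[m]\<close>,
  \<open>n2\<close> for \<open>[2]\<close>, \<open>np\<close> and \<open>npp\<close> for \<open>[m + 1]\<close> and \<open>[m + 2]\<close>,
  \<open>nm\<close> and \<open>nmm\<close> for \<open>[m - 1]\<close> and \<open>[m - 2]\<close>; \<open>B\<close> is the value of the
  coefficient \<open>A\<close> one step lower.\<close>

lemma diagonal_identity:
  fixes A :: complex
  assumes "n2 * np = n + npp" "n2 * nm = n + nmm" "npp - n = dp" "n - nmm = dm"
    "A * dp - B * dm = - n"
  shows "A * (n2 * np - 2 * n) + B * (n2 * nm - 2 * n) + n = 0"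
  using assms by Groebner_Basis.algebra

text \<open>Each relator sends \<open>ket m\<close> to a combination of at most three kets. Collecting
  coefficients leaves in each a factor that vanishes by an identity for quantum numbers.\<close>

lemma relators_vanish_on_ket:
  assumes s: "qpow h 1 - qpow h (- 1) \<noteq> 0"
    and nz: "qden h (m - 1) \<noteq> 0" "qden h m \<noteq> 0" "qden h (m + 1) \<noteq> 0"
    and r: "r \<in> uq_relators h"
  shows "act (gen_op h l) r (ket m) = 0"
proof -
  define A where "A = up_coeff h l"
  define n where "n = qnum h"
  \<comment> \<open>The factor \<open>D (m + 1)\<close> cancels from the denominator of \<open>A m\<close>, and \<open>D (m - 1)\<close> from
    that of \<open>A (m - 1)\<close>, so both terms are left over \<open>D m\<close>.\<close>
  have diag: "A m * qden h (m + 1) - A (m - 1) * qden h (m - 1) = - n m"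
  proof -
    have "A m * qden h (m + 1) = n (l + m + 1) * n (l - m) / qden h m"
      using nz by (simp add: A_def n_def up_coeff_def)
    moreover have "A (m - 1) * qden h (m - 1) = n (l + m) * n (l - m + 1) / qden h m"
      using nz by (simp add: A_def n_def up_coeff_def algebra_simps)
    ultimately have "A m * qden h (m + 1) - A (m - 1) * qden h (m - 1)
        = (n (l + m + 1) * n (l - m) - n (l + m) * n (l - m + 1)) / qden h m"
      by (simp add: diff_divide_distrib)
    also have "\<dots> = - n m"
      using nz unfolding n_def qnum_telescope[OF s] by simp
    finally show ?thesis .
  qed
  have up: "n 2 * n (m + 1) = n m + n (m + 2)"
    unfolding n_def by (rule qnum_step[OF s])
  have down: "n 2 * n (m - 1) = n m + n (m - 2)"
    using qnum_step[OF s, of "m - 2"] by (simp add: n_def add.commute)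
  have gap_up: "n (m + 2) - n m = qden h (m + 1)"
    using qnum_gap[OF s, of "m + 1"] by (simp add: n_def add.assoc)
  have gap_down: "n m - n (m - 2) = qden h (m - 1)"
    using qnum_gap[OF s, of "m - 1"] by (simp add: n_def)
  have quad_up: "n m * n m - n 2 * (n m * n (m + 1)) + n (m + 1) * n (m + 1) = 1"
    unfolding n_def by (rule qnum_quadratic[OF s])
  have quad_down: "n (m - 1) * n (m - 1) - n 2 * (n (m - 1) * n m) + n m * n m = 1"
    using qnum_quadratic[OF s, of "m - 1"] by (simp add: n_def)
  note expand = act_add_left act_diff_left act_scale_left act_mult[OF gen_op_linear] act_gens gen_op_ket
    linear_mapD[OF gen_op_linear]
  have shift: "m + 1 + 1 = m + 2" "m - 1 - 1 = m - 2" "m + 1 - 1 = m" "m - 1 + 1 = m"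
    by simp_all
  consider
    "r = gen32 * gen32 * gen21 - scale (qnum h 2) (gen32 * gen21 * gen32) + gen21 * gen32 * gen32
       + gen21"
    | "r = gen21 * gen21 * gen32 - scale (qnum h 2) (gen21 * gen32 * gen21) + gen32 * gen21 * gen21
       + gen32"
    using r by (auto simp: uq_relators_def)
  then show ?thesis
  proof cases
    case 1
    have "n m - n 2 * n (m + 1) + n (m + 2) = 0" "n m - n 2 * n (m - 1) + n (m - 2) = 0"
      using up down by simp_all
    moreover note diagonal_identity[OF up down gap_up gap_down diag]
    moreover have "act (gen_op h l) r (ket m) =
        scale (\<i> * A m * A (m + 1) * (n m - n 2 * n (m + 1) + n (m + 2))) (ket (m + 2))
      + scale (\<i> * (A m * (n 2 * n (m + 1) - 2 * n m) + A (m - 1) * (n 2 * n (m - 1) - 2 * n m)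
          + n m)) (ket m)
      + scale (\<i> * (n m - n 2 * n (m - 1) + n (m - 2))) (ket (m - 2))"
      unfolding 1 expand shift A_def[symmetric] n_def[symmetric]
      by (rule poly_mapping_eqI) (simp add: lookup_add lookup_minus algebra_simps)
    ultimately show ?thesis
      by simp
  next
    case 2
    have "act (gen_op h l) r (ket m) =
        scale (A m * (1 - (n m * n m - n 2 * (n m * n (m + 1)) + n (m + 1) * n (m + 1))))
          (ket (m + 1))
      + scale (n (m - 1) * n (m - 1) - n 2 * (n (m - 1) * n m) + n m * n m - 1) (ket (m - 1))"
      unfolding 2 expand shift A_def[symmetric] n_def[symmetric]
      by (rule poly_mapping_eqI) (simp add: lookup_add lookup_minus algebra_simps)
    then show ?thesis
      by (simp add: quad_up quad_down)
  qed
qed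

theorem theorem3p2:
  fixes h l m0 :: complex
  assumes "h \<notin> {2 * of_real pi * \<i> * r | r. r \<in> \<rat>}"
    and "\<forall>m\<in>shifts m0. qpow h (2 * m) \<noteq> - 1"
  shows "\<exists>!\<rho>. \<rho> \<in> extensional (carrier (Uq h)) \<and> uq_representation h (V m0) \<rho> \<and>
    (\<forall>m\<in>shifts m0.
       \<rho> (I21 h) (ket m) = scale (\<i> * qnum h m) (ket m) \<and>
       \<rho> (I32 h) (ket m) =
         scale (qnum h (l + m + 1) * qnum h (l - m) /
                  ((qpow h m + qpow h (- m)) * (qpow h (m + 1) + qpow h (- m - 1))))
               (ket (m + 1))
         - ket (m - 1))"
proof -
  note s = q_minus_inverse_nonzero[OF assms(1)]
  have nz: "qden h m \<noteq> 0" if "m \<in> shifts m0" for m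
    by (rule qden_nonzero) (use assms(2) that in blast)
  have rel: "act (gen_op h l) r v = 0" if r: "r \<in> uq_relators h" and v: "v \<in> V m0" for r v
  proof -
    note lin = linear_mapD[OF act_linear[OF gen_op_linear]]
    have "Poly_Mapping.keys v \<subseteq> shifts m0"
      using v by (simp add: V_def)
    then show ?thesis
    proof (induction v rule: combination_induct)
      case (basis c m)
      have "act (gen_op h l) r (ket m) = 0"
        by (rule relators_vanish_on_ket[OF s _ _ _ r]) (intro nz shifts_step basis)+
      then show ?case
        unfolding lin(2) by (simp add: ket_def)
    qed (simp_all add: lin)
  qed
  obtain \<rho> where \<rho>: "\<rho> \<in> extensional (carrier (Uq h))" "uq_representation h (V m0) \<rho>"
    "\<And>x v. v \<in> V m0 \<Longrightarrow> \<rho> (uq_class h x) v = act (gen_op h l) x v"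
    using representation_of_operators[OF gen_op_linear gen_op_V rel] by metis
  show ?thesis
  proof (rule ex1I[of _ \<rho>], intro conjI ballI)
    fix m assume m: "m \<in> shifts m0"
    show "\<rho> (I21 h) (ket m) = scale (\<i> * qnum h m) (ket m)"
      using m by (simp add: I21_def \<rho>(3) V_ket act_gens gen_op_ket)
    show "\<rho> (I32 h) (ket m) =
         scale (qnum h (l + m + 1) * qnum h (l - m) /
                  ((qpow h m + qpow h (- m)) * (qpow h (m + 1) + qpow h (- m - 1))))
               (ket (m + 1))
         - ket (m - 1)"
      using m by (simp add: I32_def \<rho>(3) V_ket act_gens gen_op_ket up_coeff_def qden_def)
  next
    fix \<sigma>
    assume \<sigma>: "\<sigma> \<in> extensional (carrier (Uq h)) \<and> uq_representation h (V m0) \<sigma> \<and>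
      (\<forall>m\<in>shifts m0.
       \<sigma> (I21 h) (ket m) = scale (\<i> * qnum h m) (ket m) \<and>
       \<sigma> (I32 h) (ket m) =
         scale (qnum h (l + m + 1) * qnum h (l - m) /
                  ((qpow h m + qpow h (- m)) * (qpow h (m + 1) + qpow h (- m - 1))))
               (ket (m + 1))
         - ket (m - 1))"
    show "\<sigma> = \<rho>"
    proof (rule representation_eqI)
      fix m assume m: "m \<in> shifts m0"
      show "\<sigma> (I21 h) (ket m) = \<rho> (I21 h) (ket m)" "\<sigma> (I32 h) (ket m) = \<rho> (I32 h) (ket m)"
        using \<sigma> m
        by (simp_all add: I21_def I32_def \<rho>(3) V_ket act_gens gen_op_ket up_coeff_def qden_def)
    qed (use \<sigma> \<rho> in auto)
  qed (use \<rho> in auto)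
qed

end
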